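(* Let $(\gamma_s,f_1,f_2):I\to AdS^3\times\Delta_1$ be a pseudo-spherical spacelike framed immersion with curvature $(\alpha,\hat\ell,0,\hat n)$, with $\alpha^2+\hat\epsilon\hat n^2\neq0$ and $g<0$ on $I$, and let $\mathcal{E}_a(\gamma_s)$ be its AdS-evolute. Then $\mathcal{E}_a(\gamma_s)$ is a pseudo-spherical framed base curve in $AdS^3$. More precisely, $(\mathcal{E}_a(\gamma_s),\mu,\eta)$ is a pseudo-spherical (spacelike or timelike) framed immersion with the curvature $(\alpha_{\mathcal{E}_a},\hat\ell_{\mathcal{E}_a},0,\hat n_{\mathcal{E}_a})$, where, with $W=\alpha\hat n'-\hat n\alpha'$ and $\mu_{\mathcal{E}_a}=\mathcal{E}_a(\gamma_s)\times\mu\times\eta$, $$\eta=\frac{\alpha\gamma_s+\hat\epsilon\hat n f_2}{\sqrt{|\alpha^2+\hat\epsilon\hat n^2|}},\qquad \mu_{\mathcal{E}_a}=\frac{W(\hat n\gamma_s-\alpha f_2)-\hat\ell\hat n(\hat\epsilon\hat n^2+\alpha^2)f_1}{\sqrt{|\alpha^2+\hat\epsilon\hat n^2|}\,\sqrt{\hat\ell^2\hat n^2(\hat n^2+\hat\epsilon\alpha^2)-\hat\epsilon W^2}},$$ $$\alpha_{\mathcal{E}_a}=\hat\epsilon\sqrt{|\alpha^2+\hat\epsilon\hat n^2|}\;\frac{\hat n\big(2\hat\ell\alpha'\hat n'+\hat n(\alpha'\hat\ell'-\hat\ell\alpha'')\big)-\alpha\big(-\hat\ell^3\hat n^2+\hat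 n\hat\ell'\hat n'+\hat\ell(2(\hat n')^2-\hat n\hat n'')\big)}{\hat\ell^2\hat n^2(\hat n^2+\hat\epsilon\alpha^2)-\hat\epsilon W^2},$$ $$\hat\ell_{\mathcal{E}_a}=\sqrt{|\alpha^2+\hat\epsilon\hat n^2|},\qquad \hat n_{\mathcal{E}_a}=-\hat\epsilon\,\frac{\sqrt{\hat\ell^2\hat n^2(\hat n^2+\hat\epsilon\alpha^2)-\hat\epsilon W^2}}{\alpha^2+\hat\epsilon\hat n^2} .$$
   Context: $\mathbb{R}^4_2$ is $\mathbb{R}^4$ with $\langle u,w\rangle=-u_1w_1-u_2w_2+u_3w_3+u_4w_4$; the triple product $u\times v\times w$ is the unique vector with $\langle x,u\times v\times w\rangle=\det(x,u,v,w)$ for all $x$. $AdS^3=\{u:\langle u,u\rangle=-1\}$, $S^3_2=\{u:\langle u,u\rangle=1\}$; $\Delta_1=\{(u,w):\langle u,w\rangle=0\}\subset AdS^3\times S^3_2$ (or $\subset S^3_2\times AdS^3$); $\Delta_5=\{(u,w)\in S^3_2\times S^3_2:\langle u,w\rangle=0\}$. A pseudo-spherical spacelike (resp. timelike) framed curve is a smooth map $(\gamma,v_1,v_2):I\to AdS^3\times\Delta_1$ (resp. $AdS^3\times\Delta_5$) with $\langle\gamma,v_i\rangle=\langle\gamma',v_i\rangle=0$, $i=1,2$; it is a framed immersion if this map is an immersion. A curve $\gamma$ is a framed base curve if such $v_1,v_2$ exist. The curvature $(\alpha,\ell,m,n)$ of $(\gamma,v_1,v_2)$ is defined, with $\nu=\gamma\times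 v_1\times v_2$, by $\gamma'=\alpha\nu$, $v_1'=\ell v_2+m\nu$, and $v_2'=\ell v_1+n\nu$ (spacelike case) or $v_2'=-\ell v_1+n\nu$ (timelike case). For the given immersion $(\gamma_s,f_1,f_2)$ put $\mu=\gamma_s\times f_1\times f_2$ and $\hat\epsilon=\langle f_1,f_1\rangle\in\{\pm1\}$ (so $\langle f_2,f_2\rangle=-\hat\epsilon$); having curvature $(\alpha,\hat\ell,0,\hat n)$ means $$\gamma_s'=\alpha\mu,\quad f_1'=\hat\ell f_2,\quad f_2'=\hat\ell f_1+\hat n\mu,\quad \mu'=\alpha\gamma_s+\hat\epsilon\hat n f_2 .$$ Put $g=\hat\epsilon(\alpha\hat n'-\hat n\alpha')^2-\hat\ell^2\hat n^2(\hat n^2+\hat\epsilon\alpha^2)$. The total evolute is $$\mathcal{E}(\gamma_s)=\pm\frac{\hat\ell\hat n(\hat n\gamma_s-\alpha f_2)-(\alpha\hat n'-\hat n\alpha')f_1}{\sqrt{|g|}} ;$$ when $g<0$ it lies in $AdS^3$, is denoted $\mathcal{E}_a(\gamma_s)$, and is called the AdS-evolute.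
   Formalization: With s=±1 the sign chosen in the total evolute, the curvature proved is (ε̂·α_E, ℓ_E, 0, s·ε̂·n_E) and E×μ×η = s·ε̂·μ_E, where α_E, ℓ_E, n_E, μ_E are the printed formulas; as printed, the signs hold for ε̂=s=1 but fail for ε̂=−1 with either s. *)

theory Defs
  imports "HOL-Analysis.Analysis"
begin

section \<open>The space \<open>\<real>\<^sup>4\<^sub>2\<close>\<close>

definition pinner :: "real^4 \<Rightarrow> real^4 \<Rightarrow> real" where
  "pinner u w = - u$1 * w$1 - u$2 * w$2 + u$3 * w$3 + u$4 * w$4"

definition triple :: "real^4 \<Rightarrow> real^4 \<Rightarrow> real^4 \<Rightarrow> real^4" where
  "triple u v w = (THE z. \<forall>x. pinner x z = det (vector [x, u, v, w] :: real^4^4))"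

definition AdS3 :: "(real^4) set" where
  "AdS3 = {u. pinner u u = -1}"

definition S32 :: "(real^4) set" where
  "S32 = {u. pinner u u = 1}"

text \<open>Both orders of the factors are admitted in \<open>\<Delta>\<^sub>1\<close>.\<close>

definition Delta1 :: "((real^4) \<times> (real^4)) set" where
  "Delta1 = {(u, w). (u, w) \<in> AdS3 \<times> S32 \<union> S32 \<times> AdS3 \<and> pinner u w = 0}"

definition Delta5 :: "((real^4) \<times> (real^4)) set" where
  "Delta5 = {(u, w). (u, w) \<in> S32 \<times> S32 \<and> pinner u w = 0}"


section \<open>Framed curves\<close>

text \<open>
  The parameter set \<open>I\<close> is an arbitrary nondegenerate interval; derivatives are taken within \<open>I\<close>,
  i.e. they are one-sided at end points belonging to \<open>I\<close>. All notions depend only on the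
  values of the curves on \<open>I\<close>.
\<close>

definition deriv_on :: "real set \<Rightarrow> (real \<Rightarrow> 'a::real_normed_vector) \<Rightarrow> real \<Rightarrow> 'a" where
  "deriv_on I f = (\<lambda>t. vector_derivative f (at t within I))"

definition smooth_on :: "real set \<Rightarrow> (real \<Rightarrow> 'a::real_normed_vector) \<Rightarrow> bool" where
  "smooth_on I f \<longleftrightarrow> (\<forall>k. \<forall>t\<in>I. (deriv_on I ^^ k) f differentiable (at t within I))"

definition framed_curve_in ::
  "((real^4) \<times> (real^4)) set \<Rightarrow> real set \<Rightarrow>
   (real \<Rightarrow> real^4) \<Rightarrow> (real \<Rightarrow> real^4) \<Rightarrow> (real \<Rightarrow> real^4) \<Rightarrow> bool" where
  "framed_curve_in \<Delta> I \<gamma> v1 v2 \<longleftrightarrow>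
     smooth_on I (\<lambda>t. (\<gamma> t, v1 t, v2 t)) \<and>
     (\<forall>t\<in>I. (\<gamma> t, v1 t, v2 t) \<in> AdS3 \<times> \<Delta> \<and>
        pinner (\<gamma> t) (v1 t) = 0 \<and> pinner (\<gamma> t) (v2 t) = 0 \<and>
        pinner (deriv_on I \<gamma> t) (v1 t) = 0 \<and> pinner (deriv_on I \<gamma> t) (v2 t) = 0)"

abbreviation "spacelike_framed_curve \<equiv> framed_curve_in Delta1"
abbreviation "timelike_framed_curve \<equiv> framed_curve_in Delta5"

definition immersion_on :: "real set \<Rightarrow> (real \<Rightarrow> 'a::real_normed_vector) \<Rightarrow> bool" where
  "immersion_on I f \<longleftrightarrow> (\<forall>t\<in>I. deriv_on I f t \<noteq> 0)"

definition spacelike_framed_immersion where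
  "spacelike_framed_immersion I \<gamma> v1 v2 \<longleftrightarrow>
     spacelike_framed_curve I \<gamma> v1 v2 \<and> immersion_on I (\<lambda>t. (\<gamma> t, v1 t, v2 t))"

definition timelike_framed_immersion where
  "timelike_framed_immersion I \<gamma> v1 v2 \<longleftrightarrow>
     timelike_framed_curve I \<gamma> v1 v2 \<and> immersion_on I (\<lambda>t. (\<gamma> t, v1 t, v2 t))"

definition framed_base_curve :: "real set \<Rightarrow> (real \<Rightarrow> real^4) \<Rightarrow> bool" where
  "framed_base_curve I \<gamma> \<longleftrightarrow>
     (\<exists>v1 v2. spacelike_framed_curve I \<gamma> v1 v2 \<or> timelike_framed_curve I \<gamma> v1 v2)"

definition spacelike_curvature where
  "spacelike_curvature I \<gamma> v1 v2 \<alpha> l m n \<longleftrightarrow>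
     (\<forall>t\<in>I. let \<nu> = triple (\<gamma> t) (v1 t) (v2 t) in
        deriv_on I \<gamma> t = \<alpha> t *\<^sub>R \<nu> \<and>
        deriv_on I v1 t = l t *\<^sub>R v2 t + m t *\<^sub>R \<nu> \<and>
        deriv_on I v2 t = l t *\<^sub>R v1 t + n t *\<^sub>R \<nu>)"

definition timelike_curvature where
  "timelike_curvature I \<gamma> v1 v2 \<alpha> l m n \<longleftrightarrow>
     (\<forall>t\<in>I. let \<nu> = triple (\<gamma> t) (v1 t) (v2 t) in
        deriv_on I \<gamma> t = \<alpha> t *\<^sub>R \<nu> \<and>
        deriv_on I v1 t = l t *\<^sub>R v2 t + m t *\<^sub>R \<nu> \<and>
        deriv_on I v2 t = - l t *\<^sub>R v1 t + n t *\<^sub>R \<nu>)"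


section \<open>The total evolute and its framing\<close>

text \<open>
  Below, \<open>(\<gamma>, f1, f2)\<close> is the given spacelike framed immersion with curvature
  \<open>(\<alpha>, l, 0, n)\<close>, and \<open>e\<close> is the constant \<open>pinner (f1 t) (f1 t)\<close>.
\<close>

definition evoW where
  "evoW I \<alpha> n t = \<alpha> t * deriv_on I n t - n t * deriv_on I \<alpha> t"

definition evoG :: "real set \<Rightarrow> real \<Rightarrow> (real \<Rightarrow> real) \<Rightarrow> (real \<Rightarrow> real) \<Rightarrow> (real \<Rightarrow> real) \<Rightarrow> real \<Rightarrow> real" where
  "evoG I e \<alpha> l n t =
     e * (evoW I \<alpha> n t)\<^sup>2 - (l t)\<^sup>2 * (n t)\<^sup>2 * ((n t)\<^sup>2 + e * (\<alpha> t)\<^sup>2)"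

text \<open>The sign \<open>s \<in> {1, -1}\<close> is the one left open in the definition of the total evolute.\<close>

definition total_evolute ::
  "real \<Rightarrow> real set \<Rightarrow> real \<Rightarrow> (real \<Rightarrow> real^4) \<Rightarrow> (real \<Rightarrow> real^4) \<Rightarrow> (real \<Rightarrow> real^4) \<Rightarrow>
   (real \<Rightarrow> real) \<Rightarrow> (real \<Rightarrow> real) \<Rightarrow> (real \<Rightarrow> real) \<Rightarrow> real \<Rightarrow> real^4" where
  "total_evolute s I e \<gamma> f1 f2 \<alpha> l n t =
     (s / sqrt \<bar>evoG I e \<alpha> l n t\<bar>) *\<^sub>R
       ((l t * n t) *\<^sub>R (n t *\<^sub>R \<gamma> t - \<alpha> t *\<^sub>R f2 t) - evoW I \<alpha> n t *\<^sub>R f1 t)"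

definition evo_eta ::
  "real \<Rightarrow> (real \<Rightarrow> real^4) \<Rightarrow> (real \<Rightarrow> real^4) \<Rightarrow> (real \<Rightarrow> real) \<Rightarrow> (real \<Rightarrow> real) \<Rightarrow> real \<Rightarrow> real^4" where
  "evo_eta e \<gamma> f2 \<alpha> n t =
     (1 / sqrt \<bar>(\<alpha> t)\<^sup>2 + e * (n t)\<^sup>2\<bar>) *\<^sub>R (\<alpha> t *\<^sub>R \<gamma> t + (e * n t) *\<^sub>R f2 t)"

definition evo_mu ::
  "real set \<Rightarrow> real \<Rightarrow> (real \<Rightarrow> real^4) \<Rightarrow> (real \<Rightarrow> real^4) \<Rightarrow> (real \<Rightarrow> real^4) \<Rightarrow>
   (real \<Rightarrow> real) \<Rightarrow> (real \<Rightarrow> real) \<Rightarrow> (real \<Rightarrow> real) \<Rightarrow> real \<Rightarrow> real^4" where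
  "evo_mu I e \<gamma> f1 f2 \<alpha> l n t =
     (1 / (sqrt \<bar>(\<alpha> t)\<^sup>2 + e * (n t)\<^sup>2\<bar> *
           sqrt ((l t)\<^sup>2 * (n t)\<^sup>2 * ((n t)\<^sup>2 + e * (\<alpha> t)\<^sup>2) - e * (evoW I \<alpha> n t)\<^sup>2))) *\<^sub>R
       (evoW I \<alpha> n t *\<^sub>R (n t *\<^sub>R \<gamma> t - \<alpha> t *\<^sub>R f2 t)
        - (l t * n t * (e * (n t)\<^sup>2 + (\<alpha> t)\<^sup>2)) *\<^sub>R f1 t)"

definition evo_alpha ::
  "real set \<Rightarrow> real \<Rightarrow> (real \<Rightarrow> real) \<Rightarrow> (real \<Rightarrow> real) \<Rightarrow> (real \<Rightarrow> real) \<Rightarrow> real \<Rightarrow> real" where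
  "evo_alpha I e \<alpha> l n t =
     (let \<alpha>' = deriv_on I \<alpha> t; \<alpha>'' = deriv_on I (deriv_on I \<alpha>) t;
          n' = deriv_on I n t; n'' = deriv_on I (deriv_on I n) t;
          l' = deriv_on I l t
      in e * sqrt \<bar>(\<alpha> t)\<^sup>2 + e * (n t)\<^sup>2\<bar> *
         (n t * (2 * l t * \<alpha>' * n' + n t * (\<alpha>' * l' - l t * \<alpha>''))
          - \<alpha> t * (- ((l t)^3 * (n t)\<^sup>2) + n t * l' * n' + l t * (2 * (n')\<^sup>2 - n t * n''))) /
         ((l t)\<^sup>2 * (n t)\<^sup>2 * ((n t)\<^sup>2 + e * (\<alpha> t)\<^sup>2) - e * (evoW I \<alpha> n t)\<^sup>2))"

definition evo_l :: "real \<Rightarrow> (real \<Rightarrow> real) \<Rightarrow> (real \<Rightarrow> real) \<Rightarrow> real \<Rightarrow> real" where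
  "evo_l e \<alpha> n t = sqrt \<bar>(\<alpha> t)\<^sup>2 + e * (n t)\<^sup>2\<bar>"

definition evo_n ::
  "real set \<Rightarrow> real \<Rightarrow> (real \<Rightarrow> real) \<Rightarrow> (real \<Rightarrow> real) \<Rightarrow> (real \<Rightarrow> real) \<Rightarrow> real \<Rightarrow> real" where
  "evo_n I e \<alpha> l n t =
     - e * (sqrt ((l t)\<^sup>2 * (n t)\<^sup>2 * ((n t)\<^sup>2 + e * (\<alpha> t)\<^sup>2) - e * (evoW I \<alpha> n t)\<^sup>2) /
            ((\<alpha> t)\<^sup>2 + e * (n t)\<^sup>2))"

text \<open>
  The expressions \<open>evo_mu\<close>, \<open>evo_alpha\<close> and \<open>evo_n\<close> are the classical closed formulas. They belong
  to one choice of orientation: for the total evolute with sign \<open>s\<close> and \<open>\<mu> = \<gamma> \<times> f1 \<times> f2\<close>,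
  the triple product \<open>total_evolute \<times> \<mu> \<times> evo_eta\<close> is \<open>s e\<close> times \<open>evo_mu\<close>. With respect to
  that triple product, which is what the definition of curvature prescribes, the curvature
  is therefore \<open>(e \<cdot> evo_alpha, evo_l, 0, s e \<cdot> evo_n)\<close>; the extra signs are all \<open>1\<close> if
  \<open>s = e = 1\<close>. If \<open>e = -1\<close>, no choice of \<open>s\<close> makes all of them \<open>1\<close>.
\<close>


section \<open>The triple product is well defined\<close>

lemma vector_4_nth:
  fixes a b c d :: "'a::zero"
  shows "(vector [a, b, c, d] :: 'a^4) $ 1 = a" "(vector [a, b, c, d] :: 'a^4) $ 2 = b"
    "(vector [a, b, c, d] :: 'a^4) $ 3 = c" "(vector [a, b, c, d] :: 'a^4) $ 4 = d"
  by (simp_all add: vector_def)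

lemma pinner_triple: "pinner x (triple u v w) = det (vector [x, u, v, w] :: real^4^4)"
proof -
  define D where "D x = det (vector [x, u, v, w] :: real^4^4)" for x
  have row: "vector [x, u, v, w] = (\<chi> i. if i = 1 then x else (vector [0, u, v, w] :: real^4^4) $ i)" for x
    by (simp add: vec_eq_iff forall_4 vector_4_nth)
  have D_add: "D (x + y) = D x + D y" for x y
    unfolding D_def row[of x] row[of y] row[of "x + y"] by (rule det_row_add)
  have D_scale: "D (c *\<^sub>R x) = c * D x" for c x
    unfolding D_def scalar_mult_eq_scaleR[symmetric] row[of x] row[of "c *s x"]
    by (rule det_row_mul)
  have expand: "x = x$1 *\<^sub>R axis 1 1 + x$2 *\<^sub>R axis 2 1 + x$3 *\<^sub>R axis 3 1 + x$4 *\<^sub>R axis 4 1"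
    for x :: "real^4"
    by (simp add: vec_eq_iff forall_4 axis_def)
  define z :: "real^4" where
    "z = vector [- D (axis 1 1), - D (axis 2 1), D (axis 3 1), D (axis 4 1)]"
  have z: "\<forall>x. pinner x z = D x"
  proof
    fix x :: "real^4"
    have "D x = x$1 * D (axis 1 1) + x$2 * D (axis 2 1) + x$3 * D (axis 3 1) + x$4 * D (axis 4 1)"
      by (rule trans[OF arg_cong[where f = D, OF expand]]) (simp only: D_add D_scale)
    then show "pinner x z = D x"
      by (simp add: pinner_def z_def vector_4_nth)
  qed
  have uniq: "y = z" if y: "\<forall>x. pinner x y = D x" for y
  proof -
    have "pinner (axis i 1) y = pinner (axis i 1) z" for i
      using y z by simp
    from this[of 1] this[of 2] this[of 3] this[of 4] show ?thesis
      by (simp add: pinner_def axis_def vec_eq_iff forall_4)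
  qed
  have "\<forall>x. pinner x (triple u v w) = D x"
    unfolding triple_def D_def[symmetric] using z uniq by (rule theI2)
  then show ?thesis by (simp add: D_def)
qed

end

theory Submission
  imports Defs
begin

text \<open>
  The triple \<open>(\<gamma>, f1, f2)\<close> together with \<open>\<mu> = \<gamma> \<times> f1 \<times> f2\<close> is a pseudo-orthonormal frame, so every
  vector is determined by its pseudo inner products with the frame. As the curvature \<open>m\<close> vanishes,
  \<open>\<mu>'\<close> lies in the span of \<open>\<gamma>\<close> and \<open>f2\<close>; the vector \<open>\<eta>\<close> is \<open>\<mu>'\<close> normalised, and the evolute is the
  unit vector orthogonal to \<open>\<mu>\<close>, \<open>\<eta>\<close> and \<open>\<eta>'\<close>. Hence its derivative is orthogonal to \<open>\<mu>\<close> and \<open>\<eta>\<close>, and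
  the curvature formulas are read off in the frame. The sign of \<open>\<alpha>\<^sup>2 + e n\<^sup>2\<close>, constant on the interval,
  decides whether the new framing is spacelike or timelike.
\<close>

section \<open>Smoothness on a perfect set\<close>

text \<open>Limit points make a derivative within \<open>I\<close> unique, so
  \<open>deriv_on\<close> can be read off from any \<open>has_vector_derivative\<close> fact.
  Connected sets with more than one point have this property.\<close>

locale perfect_domain =
  fixes I :: "real set"
  assumes islimpt: "t \<in> I \<Longrightarrow> t islimpt I"
begin

lemma deriv_on_eqI:
  assumes "(f has_vector_derivative D) (at t within I)" "t \<in> I"
  shows "deriv_on I f t = D"
  unfolding deriv_on_def using assms islimpt
  by (intro vector_derivative_within) (auto simp: trivial_limit_within)

lemma deriv_on_works:
  "f differentiable (at t within I) \<longleftrightarrow> (f has_vector_derivative deriv_on I f t) (at t within I)"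
  unfolding deriv_on_def by (rule vector_derivative_works)

lemma has_vector_derivative_cong_on:
  assumes "\<And>x. x \<in> I \<Longrightarrow> f x = g x" "t \<in> I"
  shows "(f has_vector_derivative D) (at t within I) \<longleftrightarrow> (g has_vector_derivative D) (at t within I)"
  using assms has_vector_derivative_transform by metis

lemma deriv_on_cong:
  assumes "\<And>x. x \<in> I \<Longrightarrow> f x = g x" "t \<in> I"
  shows "deriv_on I f t = deriv_on I g t"
  unfolding deriv_on_def vector_derivative_def
  using has_vector_derivative_cong_on[of f g t, OF assms] by simp

lemma differentiable_cong_on:
  assumes "\<And>x. x \<in> I \<Longrightarrow> f x = g x" "t \<in> I"
  shows "f differentiable (at t within I) \<longleftrightarrow> g differentiable (at t within I)"
  using has_vector_derivative_cong_on[of f g t "deriv_on I g t", OF assms]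
  by (simp add: deriv_on_works deriv_on_cong[of f g t, OF assms])

text \<open>Order \<open>k\<close> means that the derivatives of order 0 to \<open>k\<close> are
  differentiable. The recursion differentiates \<open>f\<close> first, so closure properties follow
  by induction on \<open>k\<close> over all functions at once, which the iterated
  \<open>deriv_on\<close> in \<open>smooth_on\<close> does not allow directly.\<close>

primrec differentiable_upto :: "nat \<Rightarrow> (real \<Rightarrow> 'a::real_normed_vector) \<Rightarrow> bool" where
  "differentiable_upto 0 f \<longleftrightarrow> (\<forall>t\<in>I. f differentiable (at t within I))"
| "differentiable_upto (Suc k) f \<longleftrightarrow>
     (\<forall>t\<in>I. f differentiable (at t within I)) \<and> differentiable_upto k (deriv_on I f)"

lemma differentiable_upto_iff:
  "differentiable_upto k f \<longleftrightarrow> (\<forall>j\<le>k. \<forall>t\<in>I. (deriv_on I ^^ j) f differentiable (at t within I))"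
proof (induction k arbitrary: f)
  case (Suc k)
  have "(\<forall>j\<le>Suc k. P j) \<longleftrightarrow> P 0 \<and> (\<forall>j\<le>k. P (Suc j))" for P
    using less_Suc_eq_0_disj less_Suc_eq_le by auto
  then show ?case
    by (simp add: Suc funpow_Suc_right del: funpow.simps(2))
qed simp

lemma smooth_on_iff_differentiable_upto: "smooth_on I f \<longleftrightarrow> (\<forall>k. differentiable_upto k f)"
  unfolding smooth_on_def differentiable_upto_iff by blast

text \<open>Formulas for derivatives agree with \<open>deriv_on I f\<close> only on
  \<open>I\<close>. Equality on \<open>I\<close> passes to \<open>deriv_on\<close>, hence the
  induction varies both functions.\<close>

lemma differentiable_upto_cong:
  "(\<And>x. x \<in> I \<Longrightarrow> f x = g x) \<Longrightarrow> differentiable_upto k f \<longleftrightarrow> differentiable_upto k g"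
proof (induction k arbitrary: f g)
  case 0
  then show ?case using differentiable_cong_on[of f g] by simp
next
  case (Suc k)
  have "differentiable_upto k (deriv_on I f) \<longleftrightarrow> differentiable_upto k (deriv_on I g)"
    by (rule Suc.IH) (rule deriv_on_cong[OF Suc.prems])
  then show ?case using differentiable_cong_on[of f g] Suc.prems by simp
qed

lemma differentiable_upto_SucI:
  assumes "\<And>t. t \<in> I \<Longrightarrow> (f has_vector_derivative f' t) (at t within I)"
    and "differentiable_upto k f'"
  shows "differentiable_upto (Suc k) f"
proof -
  have "differentiable_upto k (deriv_on I f)"
    using assms(2) by (subst differentiable_upto_cong[where g = f']) (auto intro: deriv_on_eqI assms(1))
  moreover have "f differentiable (at t within I)" if "t \<in> I" for t
    using assms(1)[OF that] by (rule differentiableI_vector)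
  ultimately show ?thesis by simp
qed

lemma differentiable_upto_imp_differentiable:
  "differentiable_upto k f \<Longrightarrow> t \<in> I \<Longrightarrow> f differentiable (at t within I)"
  by (cases k) auto

lemma differentiable_upto_has_deriv:
  "differentiable_upto k f \<Longrightarrow> t \<in> I \<Longrightarrow> (f has_vector_derivative deriv_on I f t) (at t within I)"
  using differentiable_upto_imp_differentiable deriv_on_works by blast

lemma differentiable_upto_SucD: "differentiable_upto (Suc k) f \<Longrightarrow> differentiable_upto k f"
  unfolding differentiable_upto_iff by simp

lemma differentiable_upto_const: "differentiable_upto k (\<lambda>t. c)"
proof (induction k arbitrary: c)
  case (Suc k)
  then show ?case by (intro differentiable_upto_SucI[where f' = "\<lambda>t. 0"]) auto
qed simp

lemma differentiable_upto_add:
  "differentiable_upto k f \<Longrightarrow> differentiable_upto k g \<Longrightarrow> differentiable_upto k (\<lambda>t. f t + g t)"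
proof (induction k arbitrary: f g)
  case (Suc k)
  then have "differentiable_upto k (\<lambda>t. deriv_on I f t + deriv_on I g t)"
    by simp
  then show ?case
    using Suc.prems
    by (intro differentiable_upto_SucI) (auto intro!: has_vector_derivative_add simp: deriv_on_works)
qed simp

text \<open>By the product rule the derivative is a sum of two terms of the same form, each
  available to order \<open>k\<close> by induction. One proof for all bounded bilinear maps covers
  real products, scaling and \<open>pinner\<close>.\<close>

lemma differentiable_upto_bilinear:
  assumes h: "bounded_bilinear h"
  shows "differentiable_upto k f \<Longrightarrow> differentiable_upto k g \<Longrightarrow> differentiable_upto k (\<lambda>t. h (f t) (g t))"
proof (induction k arbitrary: f g)
  case 0
  show ?case
    unfolding differentiable_upto.simps
  proof
    fix t assume "t \<in> I"
    then show "(\<lambda>t. h (f t) (g t)) differentiable (at t within I)"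
      using bounded_bilinear.has_vector_derivative[OF h
          differentiable_upto_has_deriv[OF 0(1)] differentiable_upto_has_deriv[OF 0(2)]]
        differentiableI_vector by blast
  qed
next
  case (Suc k)
  have "differentiable_upto k (\<lambda>t. h (f t) (deriv_on I g t) + h (deriv_on I f t) (g t))"
    using Suc.prems Suc.prems[THEN differentiable_upto_SucD]
    by (intro differentiable_upto_add Suc.IH) simp_all
  moreover have "((\<lambda>t. h (f t) (g t)) has_vector_derivative
      h (f t) (deriv_on I g t) + h (deriv_on I f t) (g t)) (at t within I)" if "t \<in> I" for t
    using bounded_bilinear.has_vector_derivative[OF h
        Suc.prems[THEN differentiable_upto_has_deriv, OF that]] .
  ultimately show ?case by (intro differentiable_upto_SucI)
qed

text \<open>The derivative of 1/f is -f' (1/f)^2: it contains 1/f again, but only one order lower is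
  required of it, which the induction supplies. The square root below is treated in the same way,
  with derivative f' / (2 sqrt f).\<close>

lemma differentiable_upto_inverse:
  fixes f :: "real \<Rightarrow> real"
  assumes nz: "\<And>t. t \<in> I \<Longrightarrow> f t \<noteq> 0"
  shows "differentiable_upto k f \<Longrightarrow> differentiable_upto k (\<lambda>t. inverse (f t))"
proof (induction k)
  case (Suc k)
  have inv: "differentiable_upto k (\<lambda>t. inverse (f t))"
    using Suc differentiable_upto_SucD by blast
  have "differentiable_upto k (\<lambda>t. (-1) * (deriv_on I f t * (inverse (f t) * inverse (f t))))"
    using inv Suc.prems
    by (intro differentiable_upto_bilinear[OF bounded_bilinear_mult] differentiable_upto_const) auto
  moreover have "((\<lambda>t. inverse (f t)) has_vector_derivative
      (-1) * (deriv_on I f t * (inverse (f t) * inverse (f t)))) (at t within I)" if "t \<in> I" for t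
    using differentiable_upto_has_deriv[OF Suc.prems that] nz[OF that]
    unfolding has_real_derivative_iff_has_vector_derivative[symmetric]
    by (auto intro!: derivative_eq_intros)
  ultimately show ?case by (intro differentiable_upto_SucI)
qed (use nz in simp)

lemma differentiable_upto_sqrt:
  fixes f :: "real \<Rightarrow> real"
  assumes pos: "\<And>t. t \<in> I \<Longrightarrow> f t > 0"
  shows "differentiable_upto k f \<Longrightarrow> differentiable_upto k (\<lambda>t. sqrt (f t))"
proof (induction k)
  case 0
  have "((\<lambda>t. sqrt (f t)) has_real_derivative deriv_on I f t * (inverse (sqrt (f t)) / 2)) (at t within I)"
    if "t \<in> I" for t
    using differentiable_upto_has_deriv[OF 0 that] pos[OF that]
    unfolding has_real_derivative_iff_has_vector_derivative[symmetric]
    by (auto intro!: derivative_eq_intros)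
  then show ?case
    unfolding has_real_derivative_iff_has_vector_derivative by (auto intro: differentiableI_vector)
next
  case (Suc k)
  have inv: "differentiable_upto k (\<lambda>t. inverse (sqrt (f t)))"
    using Suc differentiable_upto_SucD pos
    by (intro differentiable_upto_inverse) (auto simp: order.strict_iff_order)
  have "differentiable_upto k (\<lambda>t. deriv_on I f t * (inverse (sqrt (f t)) * (1/2)))"
    using inv Suc.prems
    by (intro differentiable_upto_bilinear[OF bounded_bilinear_mult] differentiable_upto_const) auto
  moreover have "((\<lambda>t. sqrt (f t)) has_vector_derivative
      deriv_on I f t * (inverse (sqrt (f t)) * (1/2))) (at t within I)" if "t \<in> I" for t
    using differentiable_upto_has_deriv[OF Suc.prems that] pos[OF that]
    unfolding has_real_derivative_iff_has_vector_derivative[symmetric]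
    by (auto intro!: derivative_eq_intros)
  ultimately show ?case by (intro differentiable_upto_SucI)
qed

section \<open>Derivatives and closure properties of smooth functions\<close>

lemma smooth_on_has_deriv:
  "smooth_on I f \<Longrightarrow> t \<in> I \<Longrightarrow> (f has_vector_derivative deriv_on I f t) (at t within I)"
  using smooth_on_iff_differentiable_upto differentiable_upto_has_deriv by blast

lemma smooth_on_has_real_deriv:
  fixes f :: "real \<Rightarrow> real"
  shows "smooth_on I f \<Longrightarrow> t \<in> I \<Longrightarrow> (f has_real_derivative deriv_on I f t) (at t within I)"
  unfolding has_real_derivative_iff_has_vector_derivative by (rule smooth_on_has_deriv)

lemma smooth_on_cong: "smooth_on I f \<Longrightarrow> (\<And>t. t \<in> I \<Longrightarrow> f t = g t) \<Longrightarrow> smooth_on I g"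
  using smooth_on_iff_differentiable_upto differentiable_upto_cong by metis

lemma smooth_on_const: "smooth_on I (\<lambda>t. c)"
  by (simp add: smooth_on_iff_differentiable_upto differentiable_upto_const)

lemma smooth_on_add: "smooth_on I f \<Longrightarrow> smooth_on I g \<Longrightarrow> smooth_on I (\<lambda>t. f t + g t)"
  by (simp add: smooth_on_iff_differentiable_upto differentiable_upto_add)

lemma smooth_on_bilinear:
  "bounded_bilinear h \<Longrightarrow> smooth_on I f \<Longrightarrow> smooth_on I g \<Longrightarrow> smooth_on I (\<lambda>t. h (f t) (g t))"
  by (simp add: smooth_on_iff_differentiable_upto differentiable_upto_bilinear)

lemmas smooth_on_mult = smooth_on_bilinear[OF bounded_bilinear_mult]
lemmas smooth_on_scaleR = smooth_on_bilinear[OF bounded_bilinear_scaleR]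

lemma smooth_on_linear:
  assumes "bounded_linear h" "smooth_on I f"
  shows "smooth_on I (\<lambda>t. h (f t))"
proof -
  \<comment> \<open>A linear map is the bilinear map taking c and x to c times h x, with c
    constantly 1.\<close>
  have "smooth_on I (\<lambda>t. 1 *\<^sub>R h (f t))"
    using assms(2) by (intro smooth_on_bilinear[where f = "\<lambda>_. 1" and g = f and h = "\<lambda>c x. c *\<^sub>R h x"]
        bounded_bilinear.comp[OF bounded_bilinear_scaleR bounded_linear_ident assms(1)] smooth_on_const)
  then show ?thesis by simp
qed

lemma smooth_on_minus: "smooth_on I f \<Longrightarrow> smooth_on I (\<lambda>t. - f t)"
  by (rule smooth_on_linear[OF bounded_linear_minus[OF bounded_linear_ident]])

lemma smooth_on_diff: "smooth_on I f \<Longrightarrow> smooth_on I g \<Longrightarrow> smooth_on I (\<lambda>t. f t - g t)"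
  using smooth_on_add[OF _ smooth_on_minus, of f g] by simp

lemma smooth_on_power:
  fixes f :: "real \<Rightarrow> real"
  shows "smooth_on I f \<Longrightarrow> smooth_on I (\<lambda>t. f t ^ k)"
  by (induction k) (auto intro: smooth_on_const smooth_on_mult)

lemma smooth_on_inverse_sqrt:
  fixes f :: "real \<Rightarrow> real"
  assumes "smooth_on I f" "\<And>t. t \<in> I \<Longrightarrow> f t > 0"
  shows "smooth_on I (\<lambda>t. inverse (sqrt (f t)))"
  using assms unfolding smooth_on_iff_differentiable_upto
  by (intro allI differentiable_upto_inverse differentiable_upto_sqrt)
    (auto simp: order.strict_iff_order)

lemma smooth_on_deriv_on: "smooth_on I f \<Longrightarrow> smooth_on I (deriv_on I f)"
  unfolding smooth_on_iff_differentiable_upto using differentiable_upto.simps(2) by blast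

lemma smooth_on_Pair:
  assumes "smooth_on I f" "smooth_on I g"
  shows "smooth_on I (\<lambda>t. (f t, g t))"
proof -
  have "smooth_on I (\<lambda>t. (f t, 0) + (0, g t))"
    using assms
    by (intro smooth_on_add smooth_on_linear[where h = "\<lambda>x. (x, 0)"] smooth_on_linear[where h = "\<lambda>x. (0, x)"])
      (auto intro!: bounded_linear_Pair bounded_linear_ident bounded_linear_zero)
  then show ?thesis by simp
qed

lemma smooth_on_vec:
  fixes f :: "real \<Rightarrow> real^4"
  assumes "smooth_on I (\<lambda>t. f t $ 1)" "smooth_on I (\<lambda>t. f t $ 2)"
    "smooth_on I (\<lambda>t. f t $ 3)" "smooth_on I (\<lambda>t. f t $ 4)"
  shows "smooth_on I f"
proof -
  have "smooth_on I (\<lambda>t. f t $ 1 *\<^sub>R axis 1 1 + f t $ 2 *\<^sub>R axis 2 1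
      + f t $ 3 *\<^sub>R axis 3 1 + f t $ 4 *\<^sub>R axis 4 1 :: real^4)"
    using assms by (intro smooth_on_add smooth_on_scaleR smooth_on_const)
  then show ?thesis
    by (rule smooth_on_cong) (simp add: vec_eq_iff forall_4 axis_def)
qed

end

section \<open>Pseudo-orthonormal frames of \<open>\<real>\<^sup>4\<^sub>2\<close>\<close>

text \<open>Splitting permutations of four indices into transpositions three times lists all terms
  of the determinant. Claims about the triple product then become polynomial identities in
  coordinates.\<close>

lemma det_vector_4:
  fixes x u v w :: "real^4"
  shows "det (vector [x, u, v, w] :: real^4^4) =
    x$1 * (u$2 * (v$3 * w$4 - v$4 * w$3) - u$3 * (v$2 * w$4 - v$4 * w$2) + u$4 * (v$2 * w$3 - v$3 * w$2))
  - x$2 * (u$1 * (v$3 * w$4 - v$4 * w$3) - u$3 * (v$1 * w$4 - v$4 * w$1) + u$4 * (v$1 * w$3 - v$3 * w$1))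
  + x$3 * (u$1 * (v$2 * w$4 - v$4 * w$2) - u$2 * (v$1 * w$4 - v$4 * w$1) + u$4 * (v$1 * w$2 - v$2 * w$1))
  - x$4 * (u$1 * (v$2 * w$3 - v$3 * w$2) - u$2 * (v$1 * w$3 - v$3 * w$1) + u$3 * (v$1 * w$2 - v$2 * w$1))"
proof -
  have f: "finite {2::4, 3, 4}" "1 \<notin> {2::4, 3, 4}" "finite {3::4, 4}" "2 \<notin> {3::4, 4}"
    "finite {4::4}" "3 \<notin> {4::4}"
    by auto
  show ?thesis
    unfolding det_def UNIV_4
    unfolding sum_over_permutations_insert[OF f(1,2)] sum_over_permutations_insert[OF f(3,4)]
      sum_over_permutations_insert[OF f(5,6)] permutes_sing
    by (simp add: sign_swap_id permutation_swap_id permutation_compose sign_compose sign_id swap_id_eq vector_4_nth)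
      (simp add: algebra_simps)
qed

section \<open>The bilinear form and the triple product in coordinates\<close>

lemma bounded_bilinear_pinner: "bounded_bilinear pinner"
  unfolding bilinear_conv_bounded_bilinear[symmetric] bilinear_def
  by (auto intro!: linearI simp: pinner_def algebra_simps)

interpretation pinner: bounded_bilinear pinner
  by (rule bounded_bilinear_pinner)

lemma pinner_commute: "pinner u w = pinner w u"
  by (simp add: pinner_def algebra_simps)

lemma pinner_eqI:
  assumes "\<And>x. pinner x y = pinner x z"
  shows "y = z"
  using assms[of "axis 1 1"] assms[of "axis 2 1"] assms[of "axis 3 1"] assms[of "axis 4 1"]
  by (simp add: pinner_def axis_def vec_eq_iff forall_4)

lemma triple_nth:
  "triple u v w $ 1 = - det (vector [axis 1 1, u, v, w] :: real^4^4)"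
  "triple u v w $ 2 = - det (vector [axis 2 1, u, v, w] :: real^4^4)"
  "triple u v w $ 3 = det (vector [axis 3 1, u, v, w] :: real^4^4)"
  "triple u v w $ 4 = det (vector [axis 4 1, u, v, w] :: real^4^4)"
  unfolding pinner_triple[symmetric] by (simp_all add: pinner_def axis_def)

lemma pinner_triple_orthogonal:
  "pinner u (triple u v w) = 0" "pinner v (triple u v w) = 0" "pinner w (triple u v w) = 0"
  unfolding pinner_triple det_vector_4 by (simp_all add: algebra_simps)

lemma (in perfect_domain) smooth_on_triple:
  assumes "smooth_on I u" "smooth_on I v" "smooth_on I w"
  shows "smooth_on I (\<lambda>t. triple (u t) (v t) (w t))"
  by (rule smooth_on_vec; unfold triple_nth det_vector_4;
      intro smooth_on_minus smooth_on_add smooth_on_diff smooth_on_mult smooth_on_const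
        smooth_on_linear[OF bounded_linear_vec_nth] assms)

text \<open>With \<open>J\<close> the diagonal matrix of the form, M J M^T is the Gram matrix of the
  rows of M. The two minus signs of \<open>J\<close> cancel in its determinant, so no sign
  appears.\<close>

lemma det_square_eq_det_gram:
  fixes M :: "real^4^4"
  shows "(det M)\<^sup>2 = det ((\<chi> i j. pinner (M $ i) (M $ j)) :: real^4^4)"
proof -
  define J :: "real^4^4" where "J = (\<chi> i j. if i = j then if i = 1 \<or> i = 2 then -1 else 1 else 0)"
  have "det J = 1"
    using det_diagonal[of J] unfolding UNIV_4 by (simp add: J_def)
  moreover have "M ** J ** transpose M = (\<chi> i j. pinner (M $ i) (M $ j))"
    by (simp add: vec_eq_iff matrix_matrix_mult_def transpose_def J_def sum_4 pinner_def)
  ultimately show ?thesis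
    by (metis det_mul det_transpose mult_1_right power2_eq_square)
qed

text \<open>Keeping \<open>e\<close> as a parameter with square 1 treats both orders of the factors
  in \<open>Delta1\<close> together.\<close>

locale pseudo_orthonormal =
  fixes g a b :: "real^4" and e :: real
  assumes e_square: "e * e = 1"
    and norms: "pinner g g = -1" "pinner a a = e" "pinner b b = - e"
    and orth: "pinner g a = 0" "pinner g b = 0" "pinner a b = 0"
begin

abbreviation "m \<equiv> triple g a b"

text \<open>The Gram identity is applied to the rows x, g, a, b. Its left side is the square of
  \<open>pinner x m\<close>; the Gram matrix is diagonal apart from the row and column of x, so its
  determinant is explicit. Solving for \<open>pinner x x\<close> uses e^2 = 1. Polarisation then
  gives \<open>pinner_expansion\<close>, and nondegeneracy of the form gives
  \<open>frame_expansion\<close>.\<close>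

lemma pinner_self_expansion:
  "pinner x x = - (pinner x g)\<^sup>2 + e * (pinner x a)\<^sup>2 - e * (pinner x b)\<^sup>2 + (pinner x m)\<^sup>2"
proof -
  define R :: "real^4^4" where "R = vector [x, g, a, b]"
  have "(\<chi> i j. pinner (R $ i) (R $ j)) = (vector
     [vector [pinner x x, pinner x g, pinner x a, pinner x b],
      vector [pinner x g, -1, 0, 0], vector [pinner x a, 0, e, 0], vector [pinner x b, 0, 0, -e]] :: real^4^4)"
    using orth norms by (simp add: R_def vec_eq_iff forall_4 vector_4_nth pinner_commute)
  then have "(pinner x m)\<^sup>2 = e * e * (pinner x x + (pinner x g)\<^sup>2) - e * (pinner x a)\<^sup>2 + e * (pinner x b)\<^sup>2"
    using det_square_eq_det_gram[of R]
    by (simp add: pinner_triple R_def[symmetric]) (simp add: det_vector_4 vector_4_nth power2_eq_square algebra_simps)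
  then show ?thesis using e_square by simp
qed

lemma pinner_expansion:
  "pinner x y = - pinner x g * pinner y g + e * (pinner x a * pinner y a)
     - e * (pinner x b * pinner y b) + pinner x m * pinner y m"
  using pinner_self_expansion[of "x + y"] pinner_self_expansion[of x] pinner_self_expansion[of y]
    pinner_commute[of y x]
  by (simp add: pinner.add_left pinner.add_right power2_eq_square algebra_simps)

lemma frame_expansion:
  "y = - pinner y g *\<^sub>R g + (e * pinner y a) *\<^sub>R a - (e * pinner y b) *\<^sub>R b + pinner y m *\<^sub>R m"
proof (rule pinner_eqI)
  fix x
  show "pinner x y = pinner x (- pinner y g *\<^sub>R g + (e * pinner y a) *\<^sub>R a - (e * pinner y b) *\<^sub>R b + pinner y m *\<^sub>R m)"
    by (subst pinner_expansion)
      (simp add: pinner.add_right pinner.diff_right pinner.scaleR_right pinner.minus_right algebra_simps)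
qed

text \<open>The signed sum of the self-expansions over the standard basis is a trace: \<open>4 = 3 + \<langle>m, m\<rangle>\<close>.\<close>

lemma pinner_m_m: "pinner m m = 1"
proof -
  have "pinner m m = 4 + pinner g g - e * pinner a a + e * pinner b b"
    using pinner_self_expansion[of "axis 1 1"] pinner_self_expansion[of "axis 2 1"]
      pinner_self_expansion[of "axis 3 1"] pinner_self_expansion[of "axis 4 1"]
    by (simp add: pinner_def axis_def power2_eq_square algebra_simps)
  then show ?thesis using norms e_square by simp
qed

text \<open>The pairings with g, a and b are determinants, which multilinearity reduces to multiples
  of the determinant of m, g, a, b; this equals \<open>pinner m m\<close>, that is 1. The pairing
  with m is 0, and \<open>frame_expansion\<close> recovers the vector.\<close>

lemma triple_in_frame:
  "triple (p *\<^sub>R g + q *\<^sub>R a + r *\<^sub>R b) m (c *\<^sub>R g + d *\<^sub>R b) =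
    - (q * d) *\<^sub>R g + (e * (r * c - p * d)) *\<^sub>R a + (e * q * c) *\<^sub>R b"
  (is "triple ?u m ?w = _")
proof -
  let ?D = "\<lambda>x y z w. det (vector [x, y, z, w] :: real^4^4)"
  have D: "?D m g a b = 1"
    using pinner_m_m by (simp only: pinner_triple[symmetric])
  \<comment> \<open>With an arbitrary z in place of m these are plain polynomial identities in the
    coordinates.\<close>
  have "?D g ?u z ?w = q * d * ?D z g a b" "?D a ?u z ?w = (r * c - p * d) * ?D z g a b"
    "?D b ?u z ?w = - q * c * ?D z g a b" for z
    unfolding det_vector_4 by (simp_all add: algebra_simps)
  from this[of m] have "pinner (triple ?u m ?w) g = q * d"
    "pinner (triple ?u m ?w) a = r * c - p * d" "pinner (triple ?u m ?w) b = - q * c"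
    unfolding D by (simp_all add: pinner_triple pinner_commute[of "triple _ _ _"])
  moreover have "pinner (triple ?u m ?w) m = 0"
    using pinner_triple_orthogonal(2) pinner_commute by metis
  ultimately show ?thesis
    by (subst frame_expansion) simp
qed

end

section \<open>The AdS-evolute\<close>

text \<open>Let B be the evolute without its factor \<open>s / sqrt G\<close>. Here
  \<open>W1\<close> and \<open>G1\<close> are the derivatives of \<open>W\<close> and
  \<open>G\<close>, and \<open>N\<close> is the bracket in \<open>evo_alpha\<close>. The identities
  are the components along \<gamma>, f2 and f1 of 2 G B' - G' B = 2 e N V, where V is the numerator
  of \<open>evo_mu\<close>. The left side is the numerator of the derivative of B / sqrt G.\<close>

lemma evolute_derivative_identities:
  fixes a a1 a2 n n1 n2 l l1 e :: real
  assumes e: "e = 1 \<or> e = -1"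
  defines "W \<equiv> a * n1 - n * a1" and "W1 \<equiv> a * n2 - n * a2"
    and "N \<equiv> n * (2 * l * a1 * n1 + n * (a1 * l1 - l * a2))
          - a * (- (l^3 * n\<^sup>2) + n * l1 * n1 + l * (2 * n1\<^sup>2 - n * n2))"
  defines "G \<equiv> l\<^sup>2 * n\<^sup>2 * (n\<^sup>2 + e * a\<^sup>2) - e * W\<^sup>2"
    and "G1 \<equiv> (2 * l * l1 * n\<^sup>2 + 2 * l\<^sup>2 * n * n1) * (n\<^sup>2 + e * a\<^sup>2)
          + l\<^sup>2 * n\<^sup>2 * (2 * n * n1 + 2 * e * a * a1) - 2 * e * W * W1"
  shows "2 * G * (l1 * n\<^sup>2 + 2 * l * n * n1) - G1 * (l * n\<^sup>2) = 2 * e * N * (W * n)" (is ?g)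
    and "2 * G * (l1 * n * a + l * n1 * a + l * n * a1 + W * l) - G1 * (l * n * a) = 2 * e * N * (W * a)" (is ?f2)
    and "2 * G * (l\<^sup>2 * n * a + W1) - G1 * W = 2 * e * N * (l * n * (e * n\<^sup>2 + a\<^sup>2))" (is ?f1)
proof -
  show ?g
    unfolding G_def G1_def N_def W_def W1_def using e
    by (elim disjE; simp add: algebra_simps power2_eq_square power3_eq_cube)
  show ?f2
    unfolding G_def G1_def N_def W_def W1_def using e
    by (elim disjE; simp add: algebra_simps power2_eq_square power3_eq_cube)
  show ?f1
    unfolding G_def G1_def N_def W_def W1_def using e
    by (elim disjE; simp add: algebra_simps power2_eq_square power3_eq_cube)
qed

text \<open>This is how the relations of a moving frame determine the coefficients of its
  derivatives.\<close>

lemma (in perfect_domain) pinner_deriv_const: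
  assumes f: "(f has_vector_derivative f') (at t within I)" and g: "(g has_vector_derivative g') (at t within I)"
    and c: "\<And>t. t \<in> I \<Longrightarrow> pinner (f t) (g t) = c" and t: "t \<in> I"
  shows "pinner f' (g t) = - pinner (f t) g'"
proof -
  have "deriv_on I (\<lambda>t. pinner (f t) (g t)) t = pinner (f t) g' + pinner f' (g t)"
    by (rule deriv_on_eqI[OF pinner.has_vector_derivative[OF f g] t])
  moreover have "deriv_on I (\<lambda>t. pinner (f t) (g t)) t = deriv_on I (\<lambda>t. c) t"
    by (rule deriv_on_cong[OF c t])
  moreover have "deriv_on I (\<lambda>t. c) t = 0"
    by (rule deriv_on_eqI[OF _ t]) simp
  ultimately show ?thesis by simp
qed

text \<open>The left side is the form that the product rule gives for the derivative of a normalised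
  vector y: x is the derivative of y, r its normalising square root, and h / d the logarithmic
  derivative of r.\<close>

lemma scaleR_common_denominator:
  fixes x y :: "'a::real_vector"
  assumes "r \<noteq> 0" "d \<noteq> 0"
  shows "inverse r *\<^sub>R x + (- h / (d * r)) *\<^sub>R y = inverse (d * r) *\<^sub>R (d *\<^sub>R x - h *\<^sub>R y)"
  using assms by (simp add: scaleR_diff_right divide_inverse mult.commute)

lemma DERIV_inverse_sqrt:
  fixes g :: "real \<Rightarrow> real"
  assumes "(g has_real_derivative g') (at t within A)" "g t > 0"
  shows "((\<lambda>t. inverse (sqrt (g t))) has_real_derivative - g' / (2 * g t * sqrt (g t))) (at t within A)"
  using assms by (auto intro!: derivative_eq_intros simp: field_simps)

section \<open>The given framed curve, its moving frame and its curvature\<close>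

locale spacelike_framed = perfect_domain +
  fixes \<gamma> f1 f2 :: "real \<Rightarrow> real^4" and \<alpha> l n :: "real \<Rightarrow> real" and e :: real
  assumes framed: "spacelike_framed_curve I \<gamma> f1 f2"
    and curvature: "spacelike_curvature I \<gamma> f1 f2 \<alpha> l (\<lambda>t. 0) n"
    and e: "t \<in> I \<Longrightarrow> pinner (f1 t) (f1 t) = e"
begin

abbreviation "\<mu> t \<equiv> triple (\<gamma> t) (f1 t) (f2 t)"
abbreviation "\<delta> t \<equiv> (\<alpha> t)\<^sup>2 + e * (n t)\<^sup>2"

lemma smooth_frame: "smooth_on I \<gamma>" "smooth_on I f1" "smooth_on I f2" "smooth_on I \<mu>"
proof -
  have "smooth_on I (\<lambda>t. (\<gamma> t, f1 t, f2 t))"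
    using framed by (simp add: framed_curve_in_def)
  from smooth_on_linear[OF bounded_linear_fst this]
    smooth_on_linear[OF bounded_linear_fst smooth_on_linear[OF bounded_linear_snd this]]
    smooth_on_linear[OF bounded_linear_snd smooth_on_linear[OF bounded_linear_snd this]]
  show *: "smooth_on I \<gamma>" "smooth_on I f1" "smooth_on I f2" by simp_all
  show "smooth_on I \<mu>" by (rule smooth_on_triple[OF *])
qed

lemma e_cases: "t \<in> I \<Longrightarrow> e = 1 \<or> e = -1"
  using framed e[of t] by (auto simp: framed_curve_in_def Delta1_def AdS3_def S32_def)

lemma frame:
  assumes "t \<in> I"
  shows "pseudo_orthonormal (\<gamma> t) (f1 t) (f2 t) e"
  using framed e[OF assms] assms
  by unfold_locales (auto simp: framed_curve_in_def Delta1_def AdS3_def S32_def)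

lemma frame_inner:
  assumes "t \<in> I"
  shows "pinner (\<gamma> t) (\<gamma> t) = -1" "pinner (f1 t) (f1 t) = e" "pinner (f2 t) (f2 t) = - e"
    "pinner (\<mu> t) (\<mu> t) = 1" "pinner (\<gamma> t) (f1 t) = 0" "pinner (\<gamma> t) (f2 t) = 0"
    "pinner (f1 t) (f2 t) = 0" "pinner (\<gamma> t) (\<mu> t) = 0" "pinner (f1 t) (\<mu> t) = 0"
    "pinner (f2 t) (\<mu> t) = 0" "pinner (f1 t) (\<gamma> t) = 0" "pinner (f2 t) (\<gamma> t) = 0"
    "pinner (f2 t) (f1 t) = 0" "pinner (\<mu> t) (\<gamma> t) = 0" "pinner (\<mu> t) (f1 t) = 0"
    "pinner (\<mu> t) (f2 t) = 0"
  using pseudo_orthonormal.norms[OF frame[OF assms]] pseudo_orthonormal.orth[OF frame[OF assms]]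
    pseudo_orthonormal.pinner_m_m[OF frame[OF assms]]
  by (simp_all add: pinner_triple_orthogonal pinner_commute[of "f1 t" "\<gamma> t"]
      pinner_commute[of "f2 t" "\<gamma> t"] pinner_commute[of "f2 t" "f1 t"]
      pinner_commute[of "\<mu> t" "\<gamma> t"] pinner_commute[of "\<mu> t" "f1 t"]
      pinner_commute[of "\<mu> t" "f2 t"])

lemma deriv_frame:
  assumes "t \<in> I"
  shows "deriv_on I \<gamma> t = \<alpha> t *\<^sub>R \<mu> t" "deriv_on I f1 t = l t *\<^sub>R f2 t"
    "deriv_on I f2 t = l t *\<^sub>R f1 t + n t *\<^sub>R \<mu> t"
  using curvature assms by (auto simp: spacelike_curvature_def Let_def)

lemma has_deriv_frame:
  assumes "t \<in> I"
  shows "(\<gamma> has_vector_derivative \<alpha> t *\<^sub>R \<mu> t) (at t within I)"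
    "(f1 has_vector_derivative l t *\<^sub>R f2 t) (at t within I)"
    "(f2 has_vector_derivative l t *\<^sub>R f1 t + n t *\<^sub>R \<mu> t) (at t within I)"
  using smooth_frame[THEN smooth_on_has_deriv, OF assms] unfolding deriv_frame[OF assms] by blast+

text \<open>Differentiating the constant pairings of \<mu> with the frame gives those of \<mu>', and
  \<open>frame_expansion\<close> recovers \<mu>'. The f1 component vanishes because the third
  curvature function is 0.\<close>

lemma has_deriv_\<mu>:
  assumes t: "t \<in> I"
  shows "(\<mu> has_vector_derivative \<alpha> t *\<^sub>R \<gamma> t + (e * n t) *\<^sub>R f2 t) (at t within I)"
proof -
  let ?D = "deriv_on I \<mu> t"
  have D: "(\<mu> has_vector_derivative ?D) (at t within I)"
    by (rule smooth_on_has_deriv[OF smooth_frame(4) t])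
  have "pinner ?D (\<gamma> t) = - \<alpha> t" "pinner ?D (f1 t) = 0" "pinner ?D (f2 t) = - n t" "pinner ?D (\<mu> t) = 0"
    using pinner_deriv_const[OF D has_deriv_frame(1)[OF t] frame_inner(14) t]
      pinner_deriv_const[OF D has_deriv_frame(2)[OF t] frame_inner(15) t]
      pinner_deriv_const[OF D has_deriv_frame(3)[OF t] frame_inner(16) t]
      pinner_deriv_const[OF D D frame_inner(4) t] pinner_commute[of "\<mu> t" ?D]
    by (simp_all add: pinner.scaleR_right pinner.add_right frame_inner t)
  then have "?D = \<alpha> t *\<^sub>R \<gamma> t + (e * n t) *\<^sub>R f2 t"
    by (subst pseudo_orthonormal.frame_expansion[OF frame[OF t]]) simp
  then show ?thesis using D by simp
qed

text \<open>Smoothness of the curvature comes from that of the frame: each curvature function is, up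
  to the factor -e for \<open>l\<close>, a pairing of a derivative of a frame vector with another
  frame vector.\<close>

lemma smooth_curvature: "smooth_on I \<alpha>" "smooth_on I l" "smooth_on I n"
proof -
  have sm: "smooth_on I (\<lambda>t. pinner (deriv_on I \<gamma> t) (\<mu> t))" "smooth_on I (\<lambda>t. pinner (deriv_on I f2 t) (\<mu> t))"
    "smooth_on I (\<lambda>t. - e * pinner (deriv_on I f1 t) (f2 t))"
    by (intro smooth_on_bilinear[OF bounded_bilinear_pinner] smooth_on_mult smooth_on_const
        smooth_on_deriv_on smooth_frame)+
  from sm(1,3,2) show "smooth_on I \<alpha>" "smooth_on I l" "smooth_on I n"
    by - (erule smooth_on_cong, use e_cases in \<open>force simp: deriv_frame frame_inner pinner.scaleR_left pinner.add_left\<close>)+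
qed

lemmas has_deriv_curvature =
  smooth_curvature[THEN smooth_on_has_real_deriv]
  smooth_curvature(1,3)[THEN smooth_on_deriv_on, THEN smooth_on_has_real_deriv]

end

text \<open>The constant \<open>\<sigma>\<close> is the sign of \<open>\<delta>\<close>; it decides between the spacelike and the timelike case.\<close>

locale evolute = spacelike_framed +
  fixes s \<sigma> :: real
  assumes G_neg: "t \<in> I \<Longrightarrow> evoG I e \<alpha> l n t < 0"
    and s: "s = 1 \<or> s = -1"
    and \<sigma>: "\<sigma> = 1 \<or> \<sigma> = -1"
    and \<delta>_sign: "t \<in> I \<Longrightarrow> \<sigma> * \<delta> t > 0"
begin

abbreviation "W \<equiv> evoW I \<alpha> n"
text \<open>The reversed sign makes \<open>G\<close> positive on \<open>I\<close>; by
  \<open>G_eq\<close> it is the radicand in \<open>evo_mu\<close> and \<open>evo_n\<close> and the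
  denominator of \<open>evo_alpha\<close>.\<close>

abbreviation "G t \<equiv> - evoG I e \<alpha> l n t"
abbreviation "\<alpha>1 \<equiv> deriv_on I \<alpha>"
abbreviation "\<alpha>2 \<equiv> deriv_on I \<alpha>1"
abbreviation "n1 \<equiv> deriv_on I n"
abbreviation "n2 \<equiv> deriv_on I n1"
abbreviation "l1 \<equiv> deriv_on I l"
abbreviation "E \<equiv> total_evolute s I e \<gamma> f1 f2 \<alpha> l n"
abbreviation "\<eta> \<equiv> evo_eta e \<gamma> f2 \<alpha> n"
abbreviation "V t \<equiv> (W t * n t) *\<^sub>R \<gamma> t - (W t * \<alpha> t) *\<^sub>R f2 t - (l t * n t * (e * (n t)\<^sup>2 + (\<alpha> t)\<^sup>2)) *\<^sub>R f1 t"
abbreviation "\<nu> \<equiv> evo_mu I e \<gamma> f1 f2 \<alpha> l n"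

section \<open>Smooth closed forms of the evolute and its framing\<close>

lemma smooth_W: "smooth_on I W"
  unfolding evoW_def by (intro smooth_on_diff smooth_on_mult smooth_on_deriv_on smooth_curvature)

lemma smooth_G: "smooth_on I G"
  unfolding evoG_def
  by (intro smooth_on_minus smooth_on_diff smooth_on_add smooth_on_mult smooth_on_power smooth_on_const
      smooth_W smooth_curvature)

lemma W_deriv:
  assumes "t \<in> I"
  shows "(W has_real_derivative \<alpha> t * n2 t - n t * \<alpha>2 t) (at t within I)"
  unfolding evoW_def using assms
  by (auto intro!: derivative_eq_intros has_deriv_curvature)

lemma G_deriv:
  assumes "t \<in> I"
  shows "(G has_real_derivative
      (2 * l t * l1 t * (n t)\<^sup>2 + 2 * (l t)\<^sup>2 * n t * n1 t) * ((n t)\<^sup>2 + e * (\<alpha> t)\<^sup>2)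
      + (l t)\<^sup>2 * (n t)\<^sup>2 * (2 * n t * n1 t + 2 * e * \<alpha> t * \<alpha>1 t)
      - 2 * e * W t * (\<alpha> t * n2 t - n t * \<alpha>2 t)) (at t within I)"
  unfolding evoG_def using assms
  by (auto intro!: derivative_eq_intros has_deriv_curvature W_deriv simp: algebra_simps power2_eq_square)

text \<open>The sign of \<open>G\<close> removes the absolute value, as that of \<delta> does in
  \<open>\<eta>_eq\<close>. The normalising factors become inverse roots of positive smooth
  functions; smoothness and derivatives are computed for these forms and transferred by congruence
  on \<open>I\<close>.\<close>

lemma E_eq:
  "t \<in> I \<Longrightarrow> E t = (s * inverse (sqrt (G t))) *\<^sub>R
     ((l t * (n t)\<^sup>2) *\<^sub>R \<gamma> t - (l t * n t * \<alpha> t) *\<^sub>R f2 t - W t *\<^sub>R f1 t)"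
  using G_neg[of t]
  by (simp add: total_evolute_def algebra_simps power2_eq_square divide_inverse)

lemma \<eta>_eq:
  assumes "t \<in> I"
  shows "\<eta> t = inverse (sqrt (\<sigma> * \<delta> t)) *\<^sub>R (\<alpha> t *\<^sub>R \<gamma> t + (e * n t) *\<^sub>R f2 t)"
proof -
  have "\<bar>\<delta> t\<bar> = \<sigma> * \<delta> t"
    using \<delta>_sign[OF assms] \<sigma> by auto
  then show ?thesis by (simp add: evo_eta_def divide_inverse)
qed

lemma l_eq:
  assumes "t \<in> I"
  shows "evo_l e \<alpha> n t = sqrt (\<sigma> * \<delta> t)"
  using \<delta>_sign[OF assms] \<sigma> by (auto simp: evo_l_def)

lemma G_eq: "(l t)\<^sup>2 * (n t)\<^sup>2 * ((n t)\<^sup>2 + e * (\<alpha> t)\<^sup>2) - e * (W t)\<^sup>2 = G t"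
  by (simp add: evoG_def)

lemma mu_eq:
  assumes "t \<in> I"
  shows "\<nu> t = inverse (sqrt (\<sigma> * \<delta> t) * sqrt (G t)) *\<^sub>R V t"
  unfolding evo_mu_def G_eq evo_l_def[symmetric] l_eq[OF assms]
  by (simp add: algebra_simps divide_inverse)

lemma smooth_E: "smooth_on I E"
proof -
  have "smooth_on I (\<lambda>t. (s * inverse (sqrt (G t))) *\<^sub>R
     ((l t * (n t)\<^sup>2) *\<^sub>R \<gamma> t - (l t * n t * \<alpha> t) *\<^sub>R f2 t - W t *\<^sub>R f1 t))"
    using G_neg
    by (intro smooth_on_scaleR smooth_on_diff smooth_on_mult smooth_on_power smooth_on_const smooth_on_inverse_sqrt
        smooth_G smooth_W smooth_curvature smooth_frame) auto
  then show ?thesis by (rule smooth_on_cong) (simp add: E_eq)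
qed

lemma smooth_\<eta>: "smooth_on I \<eta>"
proof -
  have "smooth_on I (\<lambda>t. inverse (sqrt (\<sigma> * \<delta> t)) *\<^sub>R (\<alpha> t *\<^sub>R \<gamma> t + (e * n t) *\<^sub>R f2 t))"
    using \<delta>_sign
    by (intro smooth_on_scaleR smooth_on_add smooth_on_mult smooth_on_power smooth_on_const smooth_on_inverse_sqrt
        smooth_curvature smooth_frame) auto
  then show ?thesis by (rule smooth_on_cong) (simp add: \<eta>_eq)
qed

lemma triple_evolute:
  assumes t: "t \<in> I"
  shows "triple (E t) (\<mu> t) (\<eta> t) = (s * e) *\<^sub>R \<nu> t"
proof -
  let ?c = "s * inverse (sqrt (G t))" and ?k = "inverse (sqrt (\<sigma> * \<delta> t))"
  have E: "E t = (?c * (l t * (n t)\<^sup>2)) *\<^sub>R \<gamma> t + (- ?c * W t) *\<^sub>R f1 t + (- ?c * (l t * n t * \<alpha> t)) *\<^sub>R f2 t"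
    unfolding E_eq[OF t] by (simp add: algebra_simps)
  have \<eta>: "\<eta> t = (?k * \<alpha> t) *\<^sub>R \<gamma> t + (?k * (e * n t)) *\<^sub>R f2 t"
    unfolding \<eta>_eq[OF t] by (simp add: algebra_simps)
  have "e * e = 1" using e_cases[OF t] by auto
  \<comment> \<open>Only the f1 coefficient contains e twice; here e^2 = 1 brings it to normal
    form.\<close>
  then have "e * (?c * ?k * (l t * n t * (e * (n t)\<^sup>2 + (\<alpha> t)\<^sup>2))) =
      ?c * ?k * (l t * n t * (n t)\<^sup>2 + e * (l t * n t * (\<alpha> t)\<^sup>2))"
    by (simp add: distrib_left mult.left_commute[of e] mult.assoc[symmetric])
  then show ?thesis
    unfolding E \<eta> pseudo_orthonormal.triple_in_frame[OF frame[OF t]] mu_eq[OF t]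
    by (simp add: algebra_simps power2_eq_square)
qed

text \<open>The product rule over a common denominator gives s (2 G B' - G' B) / (2 G sqrt G), and
  the polynomial identities turn the bracket into 2 e N V.\<close>

lemma E_deriv:
  assumes t: "t \<in> I"
  shows "(E has_vector_derivative (s * evo_alpha I e \<alpha> l n t) *\<^sub>R \<nu> t) (at t within I)"
proof -
  let ?B = "\<lambda>t. (l t * (n t)\<^sup>2) *\<^sub>R \<gamma> t - (l t * n t * \<alpha> t) *\<^sub>R f2 t - W t *\<^sub>R f1 t"
  let ?W1 = "\<alpha> t * n2 t - n t * \<alpha>2 t"
  \<comment> \<open>There is no \<mu> component: the contributions l n^2 \<alpha> from \<gamma>' and
    -l n \<alpha> n from f2' cancel.\<close>
  let ?B1 = "(l1 t * (n t)\<^sup>2 + 2 * l t * n t * n1 t) *\<^sub>R \<gamma> t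
    - (l1 t * n t * \<alpha> t + l t * n1 t * \<alpha> t + l t * n t * \<alpha>1 t + W t * l t) *\<^sub>R f2 t
    - ((l t)\<^sup>2 * n t * \<alpha> t + ?W1) *\<^sub>R f1 t"
  define N where "N = n t * (2 * l t * \<alpha>1 t * n1 t + n t * (\<alpha>1 t * l1 t - l t * \<alpha>2 t))
          - \<alpha> t * (- ((l t)^3 * (n t)\<^sup>2) + n t * l1 t * n1 t + l t * (2 * (n1 t)\<^sup>2 - n t * n2 t))"
  define G1 where "G1 = (2 * l t * l1 t * (n t)\<^sup>2 + 2 * (l t)\<^sup>2 * n t * n1 t) * ((n t)\<^sup>2 + e * (\<alpha> t)\<^sup>2)
      + (l t)\<^sup>2 * (n t)\<^sup>2 * (2 * n t * n1 t + 2 * e * \<alpha> t * \<alpha>1 t)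
      - 2 * e * W t * ?W1"
  define r where "r = sqrt (G t)"
  have r: "r > 0" "r * r = G t" "r \<noteq> 0" using G_neg[OF t] by (simp_all add: r_def)
  have B: "(?B has_vector_derivative ?B1) (at t within I)"
    by (rule derivative_eq_intros has_deriv_frame[OF t] has_deriv_curvature[OF t] W_deriv[OF t] refl)+
      (simp add: algebra_simps power2_eq_square)
  have c: "((\<lambda>t. s * inverse (sqrt (G t))) has_real_derivative s * (- G1 / (2 * G t * r))) (at t within I)"
    using G_neg[OF t] DERIV_inverse_sqrt[OF G_deriv[OF t]]
    unfolding G1_def[symmetric] r_def by (intro DERIV_cmult) simp
  have key: "(2 * G t) *\<^sub>R ?B1 - G1 *\<^sub>R ?B t = (2 * e * N) *\<^sub>R V t"
  proof -
    note id = evolute_derivative_identities[OF e_cases[OF t], where a = "\<alpha> t" and ?a1.0 = "\<alpha>1 t"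
        and ?a2.0 = "\<alpha>2 t" and n = "n t" and ?n1.0 = "n1 t" and ?n2.0 = "n2 t" and l = "l t" and ?l1.0 = "l1 t",
        folded evoW_def N_def, folded G1_def, unfolded G_eq]
    have "(2 * G t) *\<^sub>R ?B1 - G1 *\<^sub>R ?B t =
      (2 * G t * (l1 t * (n t)\<^sup>2 + 2 * l t * n t * n1 t) - G1 * (l t * (n t)\<^sup>2)) *\<^sub>R \<gamma> t
      - (2 * G t * (l1 t * n t * \<alpha> t + l t * n1 t * \<alpha> t + l t * n t * \<alpha>1 t + W t * l t) - G1 * (l t * n t * \<alpha> t)) *\<^sub>R f2 t
      - (2 * G t * ((l t)\<^sup>2 * n t * \<alpha> t + ?W1) - G1 * W t) *\<^sub>R f1 t"
      by (simp add: algebra_simps)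
    also have "\<dots> = (2 * e * N) *\<^sub>R V t"
      unfolding id by (simp add: algebra_simps)
    finally show ?thesis .
  qed
  have eq: "evo_alpha I e \<alpha> l n t = e * sqrt (\<sigma> * \<delta> t) * N / G t"
    unfolding evo_alpha_def Let_def G_eq evo_l_def[symmetric] l_eq[OF t] N_def ..
  have "((\<lambda>t. (s * inverse (sqrt (G t))) *\<^sub>R ?B t) has_vector_derivative
      (s * inverse r) *\<^sub>R ?B1 + (s * (- G1 / (2 * G t * r))) *\<^sub>R ?B t) (at t within I)"
    unfolding r_def using has_vector_derivative_scaleR[OF c B] unfolding r_def .
  then have "(E has_vector_derivative (s * inverse r) *\<^sub>R ?B1 + (s * (- G1 / (2 * G t * r))) *\<^sub>R ?B t) (at t within I)"
    by (subst has_vector_derivative_cong_on[OF E_eq t])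
  moreover have "(s * inverse r) *\<^sub>R ?B1 + (s * (- G1 / (2 * G t * r))) *\<^sub>R ?B t =
      s *\<^sub>R inverse (2 * G t * r) *\<^sub>R ((2 * G t) *\<^sub>R ?B1 - G1 *\<^sub>R ?B t)"
    using G_neg[OF t] r(3)
    by (subst scaleR_common_denominator[symmetric]) (simp_all only: scaleR_add_right scaleR_scaleR, simp)
  \<comment> \<open>The root of \<sigma> \<delta> is a factor of \<open>evo_alpha\<close> and a
    divisor in \<open>evo_mu\<close>, so it cancels.\<close>
  moreover have "s *\<^sub>R inverse (2 * G t * r) *\<^sub>R (2 * e * N) *\<^sub>R V t = (s * evo_alpha I e \<alpha> l n t) *\<^sub>R \<nu> t"
  proof -
    define d where "d = sqrt (\<sigma> * \<delta> t)"
    have "d > 0" using \<delta>_sign[OF t] by (simp only: d_def real_sqrt_gt_0_iff)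
    then show ?thesis
      using r(3) unfolding eq mu_eq[OF t] r_def[symmetric] d_def[symmetric] scaleR_scaleR
      by (simp add: divide_simps)
  qed
  ultimately show ?thesis unfolding key by simp
qed

text \<open>Here \<eta> is C / sqrt(\<sigma> \<delta>) with C = \<mu>', and the \<mu> component of
  C' is \<delta>. With h half the derivative of \<delta>, \<delta> C' - h C equals \<delta>^2 \<mu>
  - e V, since the \<gamma> and f2 components combine to multiples of \<open>W\<close>.\<close>

lemma \<eta>_deriv:
  assumes t: "t \<in> I"
  shows "(\<eta> has_vector_derivative (\<sigma> * evo_l e \<alpha> n t) *\<^sub>R \<mu> t + evo_n I e \<alpha> l n t *\<^sub>R \<nu> t) (at t within I)"
proof -
  define r where "r = sqrt (\<sigma> * \<delta> t)"
  have r: "r > 0" "r * r = \<sigma> * \<delta> t" "r \<noteq> 0" "\<delta> t \<noteq> 0"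
    using \<delta>_sign[OF t] by (auto simp: r_def)
  have \<sigma>2: "\<sigma> * \<sigma> = 1" "\<sigma> \<noteq> 0" using \<sigma> by auto
  let ?C = "\<lambda>t. \<alpha> t *\<^sub>R \<gamma> t + (e * n t) *\<^sub>R f2 t"
  let ?C1 = "\<alpha>1 t *\<^sub>R \<gamma> t + (e * n1 t) *\<^sub>R f2 t + (e * n t * l t) *\<^sub>R f1 t + \<delta> t *\<^sub>R \<mu> t"
  let ?h = "\<alpha> t * \<alpha>1 t + e * n t * n1 t"
  have C: "(?C has_vector_derivative ?C1) (at t within I)"
    by (rule derivative_eq_intros has_deriv_frame[OF t] has_deriv_curvature[OF t] refl)+
      (simp add: algebra_simps power2_eq_square)
  have d: "((\<lambda>t. \<sigma> * \<delta> t) has_real_derivative \<sigma> * (2 * ?h)) (at t within I)"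
    by (rule derivative_eq_intros has_deriv_curvature[OF t] refl)+ (simp add: algebra_simps)
  have "- (\<sigma> * (2 * ?h)) / (2 * (\<sigma> * \<delta> t) * r) = - ?h / (\<delta> t * r)"
    using \<sigma>2 r by (simp add: divide_simps)
  then have c: "((\<lambda>t. inverse (sqrt (\<sigma> * \<delta> t))) has_real_derivative - ?h / (\<delta> t * r)) (at t within I)"
    using DERIV_inverse_sqrt[OF d \<delta>_sign[OF t]] unfolding r_def by (simp only:)
  have "((\<lambda>t. inverse (sqrt (\<sigma> * \<delta> t)) *\<^sub>R ?C t) has_vector_derivative
      inverse r *\<^sub>R ?C1 + (- ?h / (\<delta> t * r)) *\<^sub>R ?C t) (at t within I)"
    using has_vector_derivative_scaleR[OF c C] unfolding r_def .
  then have "(\<eta> has_vector_derivative inverse r *\<^sub>R ?C1 + (- ?h / (\<delta> t * r)) *\<^sub>R ?C t) (at t within I)"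
    by (subst has_vector_derivative_cong_on[OF \<eta>_eq t])
  moreover have "inverse r *\<^sub>R ?C1 + (- ?h / (\<delta> t * r)) *\<^sub>R ?C t = inverse (\<delta> t * r) *\<^sub>R (\<delta> t *\<^sub>R ?C1 - ?h *\<^sub>R ?C t)"
    by (rule scaleR_common_denominator[OF r(3,4)])
  moreover have "\<delta> t *\<^sub>R ?C1 - ?h *\<^sub>R ?C t = (\<delta> t * \<delta> t) *\<^sub>R \<mu> t - e *\<^sub>R V t"
  proof -
    have "\<delta> t *\<^sub>R ?C1 - ?h *\<^sub>R ?C t = (\<delta> t * \<alpha>1 t - ?h * \<alpha> t) *\<^sub>R \<gamma> t
        + (\<delta> t * (e * n1 t) - ?h * (e * n t)) *\<^sub>R f2 t + (\<delta> t * (e * n t * l t)) *\<^sub>R f1 t + (\<delta> t * \<delta> t) *\<^sub>R \<mu> t"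
      by (simp only: scaleR_add_right scaleR_diff_left scaleR_scaleR) simp
    also have "\<delta> t * \<alpha>1 t - ?h * \<alpha> t = - e * (W t * n t)"
      by (simp add: evoW_def algebra_simps power2_eq_square)
    also have "\<delta> t * (e * n1 t) - ?h * (e * n t) = e * (W t * \<alpha> t)"
      by (simp add: evoW_def algebra_simps power2_eq_square)
    also have "\<delta> t * (e * n t * l t) = e * (l t * n t * (e * (n t)\<^sup>2 + (\<alpha> t)\<^sup>2))"
      by (simp add: algebra_simps)
    finally show ?thesis
      by (simp add: scaleR_diff_right)
  qed
  moreover have "inverse (\<delta> t * r) *\<^sub>R ((\<delta> t * \<delta> t) *\<^sub>R \<mu> t - e *\<^sub>R V t) =
     (\<sigma> * evo_l e \<alpha> n t) *\<^sub>R \<mu> t + evo_n I e \<alpha> l n t *\<^sub>R \<nu> t"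
  proof -
    have "inverse (\<delta> t * r) * (\<delta> t * \<delta> t) = \<sigma> * r"
    proof -
      \<comment> \<open>Since r^2 = \<sigma> d and \<sigma>^2 = 1, d / r = \<sigma> r. The variable
        d keeps \<delta> from being expanded as a sum.\<close>
      have "inverse (d * r) * (d * d) = \<sigma> * r" if "d \<noteq> 0" "r * r = \<sigma> * d" for d
        using that r(3) \<sigma>2(1) by (simp add: field_simps flip: mult.assoc)
      then show ?thesis using r by blast
    qed
    moreover have "inverse (\<delta> t * r) * e = - (evo_n I e \<alpha> l n t * inverse (r * sqrt (G t)))"
      using G_neg[OF t] r unfolding evo_n_def G_eq by (simp add: field_simps)
    ultimately have "inverse (\<delta> t * r) *\<^sub>R ((\<delta> t * \<delta> t) *\<^sub>R \<mu> t - e *\<^sub>R v) =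
       (\<sigma> * r) *\<^sub>R \<mu> t + evo_n I e \<alpha> l n t *\<^sub>R inverse (r * sqrt (G t)) *\<^sub>R v" for v
      unfolding scaleR_diff_right scaleR_scaleR by simp
    then show ?thesis
      unfolding l_eq[OF t] mu_eq[OF t] r_def[symmetric] .
  qed
  ultimately show ?thesis by simp
qed

text \<open>In the frame the unnormalised vectors have self-products -G and -\<delta> and are
  orthogonal. As \<delta> has sign \<sigma>, \<eta> lies in \<open>AdS3\<close> for \<sigma> = 1 and
  in \<open>S32\<close> for \<sigma> = -1.\<close>

lemma evolute_inner:
  assumes t: "t \<in> I"
  shows "pinner (E t) (E t) = -1" "pinner (\<eta> t) (\<eta> t) = - \<sigma>" "pinner (E t) (\<mu> t) = 0"
    "pinner (E t) (\<eta> t) = 0" "pinner (\<mu> t) (\<eta> t) = 0"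
proof -
  note bilin = pinner.add_left pinner.add_right pinner.diff_left pinner.diff_right
    pinner.scaleR_left pinner.scaleR_right frame_inner[OF t]
  let ?B = "(l t * (n t)\<^sup>2) *\<^sub>R \<gamma> t - (l t * n t * \<alpha> t) *\<^sub>R f2 t - W t *\<^sub>R f1 t"
    and ?C = "\<alpha> t *\<^sub>R \<gamma> t + (e * n t) *\<^sub>R f2 t"
  define k where "k = s * inverse (sqrt (G t))"
  define h where "h = inverse (sqrt (\<sigma> * \<delta> t))"
  have E: "E t = k *\<^sub>R ?B" and \<eta>: "\<eta> t = h *\<^sub>R ?C"
    unfolding k_def h_def E_eq[OF t] \<eta>_eq[OF t] by simp_all
  have sG: "sqrt (G t) * sqrt (G t) = G t" using G_neg[OF t] by simp
  have "k * k = s * s * inverse (sqrt (G t) * sqrt (G t))"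
    by (simp only: k_def inverse_mult_distrib mult_ac)
  also have "\<dots> = inverse (G t)"
    unfolding sG using s by auto
  finally have k: "k * k * - G t = -1" using G_neg[OF t] by simp
  have "h * h = inverse (sqrt (\<sigma> * \<delta> t) * sqrt (\<sigma> * \<delta> t))"
    by (simp only: h_def inverse_mult_distrib)
  also have "\<dots> = \<sigma> * inverse (\<delta> t)"
    using \<sigma> \<delta>_sign[OF t] by auto
  finally have hh: "h * h = \<sigma> * inverse (\<delta> t)" .
  have "\<delta> t \<noteq> 0" using \<delta>_sign[OF t] by auto
  from left_inverse[OF this] have h: "h * h * - \<delta> t = - \<sigma>"
    unfolding hh mult_minus_right mult.assoc by (simp only: mult_1_right)
  have "pinner ?B ?B = - G t"
    unfolding evoG_def by (simp add: bilin) (simp add: algebra_simps power2_eq_square)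
  then show "pinner (E t) (E t) = -1"
    using k unfolding E pinner.scaleR_left pinner.scaleR_right by simp
  have "pinner ?C ?C = - \<delta> t"
    using e_cases[OF t] by (auto simp: bilin power2_eq_square)
  then show "pinner (\<eta> t) (\<eta> t) = - \<sigma>"
    using h unfolding \<eta> pinner.scaleR_left pinner.scaleR_right by simp
  show "pinner (E t) (\<mu> t) = 0" "pinner (\<mu> t) (\<eta> t) = 0"
    unfolding E \<eta> by (simp_all add: bilin)
  have "pinner ?B ?C = 0"
    using e_cases[OF t] by (auto simp: bilin power2_eq_square)
  then show "pinner (E t) (\<eta> t) = 0"
    unfolding E \<eta> pinner.scaleR_left pinner.scaleR_right by simp
qed

text \<open>Curvature is measured along the triple product, which is \<open>s * e\<close> times
  \<open>evo_mu\<close>. Coefficients along \<open>evo_mu\<close> are thus multiplied by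
  \<open>s * e\<close>, whose square is 1: the sign s becomes e for the evolute, and 1 becomes
  \<open>s * e\<close> for \<eta>.\<close>

lemma deriv_evolute:
  assumes t: "t \<in> I"
  defines "\<nu>' \<equiv> triple (E t) (\<mu> t) (\<eta> t)"
  shows "deriv_on I E t = (e * evo_alpha I e \<alpha> l n t) *\<^sub>R \<nu>'"
    and "deriv_on I \<mu> t = evo_l e \<alpha> n t *\<^sub>R \<eta> t"
    and "deriv_on I \<eta> t = (\<sigma> * evo_l e \<alpha> n t) *\<^sub>R \<mu> t + (s * e * evo_n I e \<alpha> l n t) *\<^sub>R \<nu>'"
proof -
  have sq: "e * e = 1" "s * s = 1" using e_cases[OF t] s by auto
  have "(e * x) *\<^sub>R \<nu>' = (s * x) *\<^sub>R \<nu> t" "(s * e * x) *\<^sub>R \<nu>' = x *\<^sub>R \<nu> t" for x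
  proof -
    have "e * x * (s * e) = (e * e) * (s * x)" "s * e * x * (s * e) = (s * s) * (e * e) * x"
      by simp_all
    then show "(e * x) *\<^sub>R \<nu>' = (s * x) *\<^sub>R \<nu> t" "(s * e * x) *\<^sub>R \<nu>' = x *\<^sub>R \<nu> t"
      unfolding \<nu>'_def triple_evolute[OF t] scaleR_scaleR by (simp_all only: sq mult_1_left)
  qed
  then show "deriv_on I E t = (e * evo_alpha I e \<alpha> l n t) *\<^sub>R \<nu>'"
    "deriv_on I \<eta> t = (\<sigma> * evo_l e \<alpha> n t) *\<^sub>R \<mu> t + (s * e * evo_n I e \<alpha> l n t) *\<^sub>R \<nu>'"
    using deriv_on_eqI[OF E_deriv[OF t] t] deriv_on_eqI[OF \<eta>_deriv[OF t] t] by simp_all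
  have "sqrt (\<sigma> * \<delta> t) \<noteq> 0" using \<delta>_sign[OF t] by auto
  then show "deriv_on I \<mu> t = evo_l e \<alpha> n t *\<^sub>R \<eta> t"
    using deriv_on_eqI[OF has_deriv_\<mu>[OF t] t] unfolding l_eq[OF t] \<eta>_eq[OF t] by simp
qed

section \<open>The evolute with framing (\<mu>, \<eta>) as a framed immersion\<close>

lemma framed_curve_evolute:
  assumes "\<And>t. t \<in> I \<Longrightarrow> (\<mu> t, \<eta> t) \<in> \<Delta>"
  shows "framed_curve_in \<Delta> I E \<mu> \<eta>"
  unfolding framed_curve_in_def
proof (intro conjI ballI)
  show "smooth_on I (\<lambda>t. (E t, \<mu> t, \<eta> t))"
    by (intro smooth_on_Pair smooth_E smooth_frame smooth_\<eta>)
qed (auto simp: assms AdS3_def evolute_inner deriv_evolute pinner.scaleR_left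
    pinner_commute[of "triple _ _ _"] pinner_triple_orthogonal)

text \<open>The middle component alone suffices: \<mu>' is a positive multiple of \<eta>, and \<eta>
  is nonzero since its self-product is -\<sigma>.\<close>

lemma immersion_evolute: "immersion_on I (\<lambda>t. (E t, \<mu> t, \<eta> t))"
  unfolding immersion_on_def
proof
  fix t assume t: "t \<in> I"
  let ?D = "deriv_on I (\<lambda>t. (E t, \<mu> t, \<eta> t)) t"
  have "((\<lambda>t. (E t, \<mu> t, \<eta> t)) has_vector_derivative ?D) (at t within I)"
    by (intro smooth_on_has_deriv smooth_on_Pair smooth_E smooth_frame smooth_\<eta> t)
  from bounded_linear.has_vector_derivative[OF bounded_linear_fst
      bounded_linear.has_vector_derivative[OF bounded_linear_snd this]]
  have "deriv_on I \<mu> t = fst (snd ?D)"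
    by (intro deriv_on_eqI t) simp
  moreover have "deriv_on I \<mu> t \<noteq> 0"
    using \<delta>_sign[OF t] evolute_inner(2)[OF t] \<sigma>
    by (auto simp: deriv_evolute(2)[OF t] l_eq[OF t] pinner.zero_left)
  ultimately show "?D \<noteq> 0" by auto
qed

text \<open>The factor \<sigma> in the \<mu> component of \<eta>' is exactly the sign by which the
  two definitions of curvature differ.\<close>

lemma evolute_spacelike:
  assumes "\<sigma> = 1"
  shows "spacelike_framed_immersion I E \<mu> \<eta>"
    and "spacelike_curvature I E \<mu> \<eta> (\<lambda>t. e * evo_alpha I e \<alpha> l n t) (evo_l e \<alpha> n) (\<lambda>t. 0)
      (\<lambda>t. s * e * evo_n I e \<alpha> l n t)"
  using framed_curve_evolute[of Delta1] immersion_evolute assms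
  by (auto simp: spacelike_framed_immersion_def Delta1_def AdS3_def S32_def evolute_inner frame_inner
      spacelike_curvature_def Let_def deriv_evolute)

lemma evolute_timelike:
  assumes "\<sigma> = -1"
  shows "timelike_framed_immersion I E \<mu> \<eta>"
    and "timelike_curvature I E \<mu> \<eta> (\<lambda>t. e * evo_alpha I e \<alpha> l n t) (evo_l e \<alpha> n) (\<lambda>t. 0)
      (\<lambda>t. s * e * evo_n I e \<alpha> l n t)"
  using framed_curve_evolute[of Delta5] immersion_evolute assms
  by (auto simp: timelike_framed_immersion_def Delta5_def S32_def evolute_inner frame_inner
      timelike_curvature_def Let_def deriv_evolute)

end

text \<open>Values of opposite sign would put 0 into the connected image of \<open>I\<close>.
  Applied to \<delta>, this provides one \<sigma> for the whole interval.\<close>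

lemma connected_constant_sign:
  fixes f :: "real \<Rightarrow> real"
  assumes "connected I" "continuous_on I f" "\<forall>t\<in>I. f t \<noteq> 0"
  obtains \<sigma> where "\<sigma> = 1 \<or> \<sigma> = -1" "\<forall>t\<in>I. \<sigma> * f t > 0"
proof -
  have "connected (f ` I)"
    using assms by (intro connected_continuous_image)
  then have "\<not> (f x < 0 \<and> f y > 0)" if "x \<in> I" "y \<in> I" for x y
    using connectedD_interval[of "f ` I" "f x" "f y" 0] that assms(3) by force
  then have "(\<forall>t\<in>I. 1 * f t > 0) \<or> (\<forall>t\<in>I. -1 * f t > 0)"
    using assms(3) by (metis linorder_neqE_linordered_idom mult_1 mult_minus1 neg_0_less_iff_less)
  then show ?thesis using that by blast
qed

theorem theorem4p3:
  fixes I :: "real set"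
    and \<gamma> f1 f2 :: "real \<Rightarrow> real^4"
    and \<alpha> l n :: "real \<Rightarrow> real"
    and e s :: real
  assumes "is_interval I" and "interior I \<noteq> {}"
    and "spacelike_framed_immersion I \<gamma> f1 f2"
    and "spacelike_curvature I \<gamma> f1 f2 \<alpha> l (\<lambda>t. 0) n"
    and "\<forall>t\<in>I. pinner (f1 t) (f1 t) = e"
    and "\<forall>t\<in>I. (\<alpha> t)\<^sup>2 + e * (n t)\<^sup>2 \<noteq> 0"
    and "\<forall>t\<in>I. evoG I e \<alpha> l n t < 0"
    and "s \<in> {1, -1}"
  shows "let \<mu> = (\<lambda>t. triple (\<gamma> t) (f1 t) (f2 t));
             \<eta> = evo_eta e \<gamma> f2 \<alpha> n;
             E = total_evolute s I e \<gamma> f1 f2 \<alpha> l n;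
             \<alpha>\<^sub>E = (\<lambda>t. e * evo_alpha I e \<alpha> l n t);
             l\<^sub>E = evo_l e \<alpha> n;
             n\<^sub>E = (\<lambda>t. s * e * evo_n I e \<alpha> l n t)
         in framed_base_curve I E \<and>
            (spacelike_framed_immersion I E \<mu> \<eta> \<and>
               spacelike_curvature I E \<mu> \<eta> \<alpha>\<^sub>E l\<^sub>E (\<lambda>t. 0) n\<^sub>E
             \<or> timelike_framed_immersion I E \<mu> \<eta> \<and>
               timelike_curvature I E \<mu> \<eta> \<alpha>\<^sub>E l\<^sub>E (\<lambda>t. 0) n\<^sub>E) \<and>
            (\<forall>t\<in>I. triple (E t) (\<mu> t) (\<eta> t) = (s * e) *\<^sub>R evo_mu I e \<gamma> f1 f2 \<alpha> l n t)"
proof -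
  have conn: "connected I" using assms(1) by (simp add: is_interval_connected_1)
  \<comment> \<open>A nonempty interior rules out singletons, so the connected set \<open>I\<close>
    has no isolated points, as \<open>perfect_domain\<close> requires.\<close>
  have "I \<noteq> {t}" for t using assms(2) by auto
  then interpret spacelike_framed I \<gamma> f1 f2 \<alpha> l n e
    using assms(3-5) connected_imp_perfect[OF conn]
    by unfold_locales (auto simp: spacelike_framed_immersion_def)
  have "continuous_on I \<alpha>" "continuous_on I n"
    using has_deriv_curvature(1,3)[THEN DERIV_continuous]
    by (auto simp: continuous_on_eq_continuous_within)
  then have "continuous_on I \<delta>"
    by (intro continuous_intros)
  then obtain \<sigma> where \<sigma>: "\<sigma> = 1 \<or> \<sigma> = -1" "\<forall>t\<in>I. \<sigma> * \<delta> t > 0"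
    using connected_constant_sign[OF conn _ assms(6)] by blast
  interpret evolute I \<gamma> f1 f2 \<alpha> l n e s \<sigma>
    using assms(7,8) \<sigma> by unfold_locales auto
  from \<sigma>(1) have "spacelike_framed_immersion I E \<mu> \<eta> \<and>
       spacelike_curvature I E \<mu> \<eta> (\<lambda>t. e * evo_alpha I e \<alpha> l n t) (evo_l e \<alpha> n) (\<lambda>t. 0)
         (\<lambda>t. s * e * evo_n I e \<alpha> l n t) \<or>
     timelike_framed_immersion I E \<mu> \<eta> \<and>
       timelike_curvature I E \<mu> \<eta> (\<lambda>t. e * evo_alpha I e \<alpha> l n t) (evo_l e \<alpha> n) (\<lambda>t. 0)
         (\<lambda>t. s * e * evo_n I e \<alpha> l n t)"
    using evolute_spacelike evolute_timelike by blast
  then show ?thesis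
    unfolding Let_def framed_base_curve_def
    using triple_evolute by (auto simp: spacelike_framed_immersion_def timelike_framed_immersion_def)
qed

end
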